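(* Let $n$ be a non-negative integer. Then $$\sum_{k=0}^n(-1)^k\binom nk2^{n-2k}\binom{2k}k=\sum_{k=0}^{\lfloor n/2\rfloor}\binom n{2k}2^{-2k}\binom{2k}k;$$ if $n\neq0$, $$\sum_{k=0}^{\lfloor n/2\rfloor}\binom n{2k}\frac1{2k+1}=\frac{2^{n-1}}{2^n-1}\sum_{k=1}^{\lceil n/2\rceil}\binom n{2k-1}\frac1k;$$ and $$\sum_{k=0}^n(-1)^k\binom nk\frac{2k+1}{k+2}\,2^{n-2k+1}C_k=\sum_{k=0}^{\lfloor n/2\rfloor}\binom n{2k}2^{-2k}C_k.$$
   Context: $C_j=\frac1{j+1}\binom{2j}j$ denotes the $j$-th Catalan number, for $j$ a non-negative integer. *)

theory Defs imports Complex_Main begin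

definition catalan :: "nat \<Rightarrow> real" where
  "catalan j = 1 / (real j + 1) * real ((2 * j) choose j)"

end

(* Both sides of the first identity equal (2n choose n) / 2^n, and both sides of the third equal
   C_(n+1) / 2^n. The alternating sums are instances of the Vandermonde convolution with upper
   arguments -1/2 and -3/2. The other sums are coefficients of (1 + x)^(2n), expanded as
   ((1 + x^2) + 2x)^n; for the third identity this uses C_k = (2k choose k) - (2k choose (k+1)).
   In the second identity, the factors 1/(2k+1) and 1/k are absorbed into the binomial coefficients,
   which leaves sums of (n+1 choose i) over the i of one parity. *)
theory Submission
  imports Defs "HOL-Computational_Algebra.Polynomial" "HOL-Computational_Algebra.Formal_Power_Series"
begin

text \<open>In the alternating sums \<open>k\<close> runs up to \<open>n\<close>, so the exponent
  may be negative. Splitting it isolates a factor 2^n independent of \<open>k\<close> and a weight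
  1/4^k.\<close>

lemma two_powi_diff: "(2 :: real) powi (int n - 2 * int k) = 2 ^ n / 4 ^ k"
proof -
  have "(2 :: real) powi (int n - int (2 * k)) = 2 ^ n / 2 ^ (2 * k)"
    by (subst power_int_diff, simp) (simp only: power_int_of_nat)
  then show ?thesis
    by (simp add: power_mult)
qed

lemma nat_floor_half: "nat \<lfloor>real n / 2\<rfloor> = n div 2"
  using floor_divide_of_nat_eq[of n 2, where ?'a = real] by simp

lemma nat_ceiling_half: "nat \<lceil>real n / 2\<rceil> = Suc n div 2"
  by (cases "even n") (auto elim!: evenE oddE simp: ceiling_eq_iff nat_eq_iff add_divide_distrib)

lemma sum_even:
  fixes f :: "nat \<Rightarrow> 'a :: comm_monoid_add"
  shows "(\<Sum>i\<le>n. if even i then f i else 0) = (\<Sum>k=0..n div 2. f (2 * k))"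
proof -
  have "(\<Sum>i\<le>n. if even i then f i else 0) = sum f {i \<in> {..n}. even i}"
    by (rule sum.inter_filter[symmetric]) simp
  also have "\<dots> = (\<Sum>k=0..n div 2. f (2 * k))"
    by (rule sum.reindex_bij_witness[of _ "\<lambda>k. 2 * k" "\<lambda>i. i div 2"]) auto
  finally show ?thesis .
qed

lemma sum_odd:
  fixes f :: "nat \<Rightarrow> 'a :: comm_monoid_add"
  shows "(\<Sum>i\<le>Suc n. if odd i then f i else 0) = (\<Sum>k=0..n div 2. f (Suc (2 * k)))"
proof -
  have "(\<Sum>i\<le>Suc n. if odd i then f i else 0) = sum f {i \<in> {..Suc n}. odd i}"
    by (rule sum.inter_filter[symmetric]) simp
  also have "\<dots> = (\<Sum>k=0..n div 2. f (Suc (2 * k)))"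
    by (rule sum.reindex_bij_witness[of _ "\<lambda>k. Suc (2 * k)" "\<lambda>i. i div 2"]) (auto elim!: oddE)
  finally show ?thesis .
qed

text \<open>Since (-1)^k (c)_k / k! is the generalized binomial coefficient of -c over k, this is a
  Vandermonde convolution. It is used for (c, m) = (1/2, 0) and (3/2, 2), where m + 1 - c = c, so
  the sum reproduces the Pochhammer symbol it started from.\<close>

lemma vandermonde_pochhammer:
  "(\<Sum>k\<le>n. (- 1) ^ k * real ((n + m) choose (n - k)) * pochhammer c k / fact k)
    = pochhammer (real m + 1 - c) n / fact n"
proof -
  have "(\<Sum>k\<le>n. (- 1) ^ k * real ((n + m) choose (n - k)) * pochhammer c k / fact k)
      = (\<Sum>k\<le>n. (- c gchoose k) * (real (n + m) gchoose (n - k)))"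
    by (intro sum.cong refl) (simp add: gbinomial_pochhammer[of "- c"] binomial_gbinomial)
  also have "\<dots> = (- c + real (n + m)) gchoose n"
    unfolding atMost_atLeast0 by (rule gbinomial_Vandermonde)
  also have "\<dots> = pochhammer (real m + 1 - c) n / fact n"
    by (simp add: gbinomial_pochhammer' algebra_simps)
  finally show ?thesis .
qed

lemma central_binomial_pochhammer:
  "real ((2 * k) choose k) / 4 ^ k = pochhammer (1 / 2) k / fact k"
proof -
  have "real ((2 * k) choose k) = fact (2 * k) / (fact k * fact k)"
    by (simp add: binomial_fact)
  then show ?thesis
    by (simp add: fact_double power_mult)
qed

text \<open>Splitting off the first factor of (1/2)_(k+1) leaves (3/2)_k / 2; the Catalan
  denominator k + 2 completes (k+1)! to (k+2)!.\<close>

lemma catalan_Suc_pochhammer: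
  "catalan (Suc k) / 4 ^ k = 2 * pochhammer (3 / 2) k / fact (k + 2)"
proof -
  have "real ((2 * Suc k) choose Suc k) / 4 ^ Suc k = 1 / 2 * pochhammer (3 / 2) k / fact (Suc k)"
    unfolding central_binomial_pochhammer pochhammer_rec by simp
  then have *: "real ((2 * Suc k) choose Suc k) = 2 * 4 ^ k * pochhammer (3 / 2) k / fact (Suc k)"
    by (simp add: field_simps del: fact_Suc binomial_Suc_Suc)
  show ?thesis
    unfolding catalan_def * by (simp add: divide_simps del: fact_Suc) (simp add: algebra_simps)
qed

lemma alternating_sum_central_binomial:
  "(\<Sum>k\<le>n. (- 1) ^ k * real (n choose k) * (real ((2 * k) choose k) / 4 ^ k))
    = real ((2 * n) choose n) / 4 ^ n"
proof -
  have "(\<Sum>k\<le>n. (- 1) ^ k * real (n choose k) * (real ((2 * k) choose k) / 4 ^ k))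
      = (\<Sum>k\<le>n. (- 1) ^ k * real ((n + 0) choose (n - k)) * pochhammer (1 / 2) k / fact k)"
    unfolding central_binomial_pochhammer
    by (intro sum.cong refl) (simp add: binomial_symmetric[symmetric])
  then show ?thesis
    unfolding vandermonde_pochhammer central_binomial_pochhammer by simp
qed

lemma alternating_sum_catalan_Suc:
  "(\<Sum>k\<le>n. (- 1) ^ k * real (n choose k) * (catalan (Suc k) / 4 ^ k)) = catalan (Suc n) / 4 ^ n"
proof -
  \<comment> \<open>The k! from (n choose k) and the (k+2)! from the Catalan number exchange roles:
    (k+2)! joins (n-k)! to form (n+2 choose n-k), which gives m = 2.\<close>
  have "(\<Sum>k\<le>n. (- 1) ^ k * real (n choose k) * (catalan (Suc k) / 4 ^ k))
      = (\<Sum>k\<le>n. 2 * fact n / fact (n + 2) *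
          ((- 1) ^ k * real ((n + 2) choose (n - k)) * pochhammer (3 / 2) k / fact k))"
  proof (intro sum.cong refl)
    fix k assume "k \<in> {..n}"
    then have k: "k \<le> n" by simp
    have 1: "real (n choose k) = fact n / (fact k * fact (n - k))"
      using k by (simp add: binomial_fact)
    have 2: "real ((n + 2) choose (n - k)) = fact (n + 2) / (fact (n - k) * fact (k + 2))"
      using k binomial_fact[of "n - k" "n + 2", where ?'a = real] by (simp add: Suc_diff_le del: fact_Suc binomial_Suc_Suc)
    show "(- 1) ^ k * real (n choose k) * (catalan (Suc k) / 4 ^ k)
      = 2 * fact n / fact (n + 2) *
          ((- 1) ^ k * real ((n + 2) choose (n - k)) * pochhammer (3 / 2) k / fact k)"
      unfolding catalan_Suc_pochhammer 1 2 by (simp add: ac_simps del: fact_Suc add_2_eq_Suc')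
  qed
  then show ?thesis
    unfolding sum_distrib_left[symmetric] vandermonde_pochhammer catalan_Suc_pochhammer by simp
qed

lemma coeff_one_plus_monom_power:
  assumes "d > 0"
  shows "coeff ((1 + monom 1 d) ^ i) m = (if d dvd m then of_nat (i choose (m div d)) else (0 :: 'a :: comm_ring_1))"
proof -
  have "coeff ((1 + monom (1 :: 'a) d) ^ i) m = (\<Sum>k\<le>i. of_nat (i choose k) * coeff (monom 1 (d * k)) m)"
    unfolding add.commute[of 1]
    by (simp add: binomial_ring coeff_sum monom_power of_nat_poly)
  also have "\<dots> = (\<Sum>k\<le>i. if k = m div d then if d dvd m then of_nat (i choose k) else 0 else 0)"
    using assms by (intro sum.cong) auto
  \<comment> \<open>If \<open>m div d\<close> exceeds \<open>i\<close>, no index is selected, and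
    the binomial coefficient on the right vanishes as well.\<close>
  also have "\<dots> = (if d dvd m then of_nat (i choose (m div d)) else 0)"
    by (auto simp: binomial_eq_0)
  finally show ?thesis .
qed

lemma sum_binomial_even:
  "(\<Sum>k=0..n div 2. (n choose (2 * k)) * 2 ^ (n - 2 * k) * ((2 * k) choose (k + d)))
    = (2 * n) choose (n + 2 * d)"
proof -
  have "monom (2 :: int) 1 = monom 1 1 + monom 1 1"
    by (simp add: add_monom)
  then have "(1 + monom (1 :: int) 1)\<^sup>2 = 1 + monom 1 2 + monom 2 1"
    by (simp add: power2_eq_square distrib_left distrib_right mult_monom add.assoc numeral_2_eq_2)
  then have "(1 + monom (1 :: int) 1) ^ (2 * n) = (1 + monom 1 2 + monom 2 1) ^ n"
    by (simp add: power_mult)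
  also have "\<dots> = (\<Sum>i\<le>n. of_nat (n choose i) * (monom (2 ^ (n - i)) (n - i) * (1 + monom 1 2) ^ i))"
    unfolding binomial_ring[of "1 + monom 1 2"]
    by (intro sum.cong refl) (simp add: monom_power mult.assoc mult.commute[of "monom _ _"])
  finally have expansion: "(1 + monom (1 :: int) 1) ^ (2 * n) = \<dots>" .
  \<comment> \<open>The factor (2x)^(n-i) uses up n - i of the degree n + 2d, so degree i + 2d
    remains for (1 + x^2)^i. Only even \<open>i\<close> contribute, because that power has no
    odd-degree terms.\<close>
  have "coeff ((1 + monom (1 :: int) 1) ^ (2 * n)) (n + 2 * d)
      = (\<Sum>i\<le>n. int (n choose i) * 2 ^ (n - i) * coeff ((1 + monom 1 2) ^ i) (i + 2 * d))"
    unfolding expansion coeff_sum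
    by (intro sum.cong refl) (auto simp: of_nat_poly coeff_monom_mult add.commute)
  also have "\<dots> = (\<Sum>i\<le>n. if even i then
      int ((n choose i) * 2 ^ (n - i) * (i choose (i div 2 + d))) else 0)"
    by (intro sum.cong refl) (simp add: coeff_one_plus_monom_power)
  also have "\<dots> = int (\<Sum>k=0..n div 2. (n choose (2 * k)) * 2 ^ (n - 2 * k) * ((2 * k) choose (k + d)))"
    unfolding sum_even by simp
  finally show ?thesis
    by (simp add: coeff_one_plus_monom_power flip: of_nat_eq_iff[where ?'a = int])
qed

lemma sum_binomial_even_real:
  "(\<Sum>k=0..n div 2. real (n choose (2 * k)) / 4 ^ k * real ((2 * k) choose (k + d)))
    = real ((2 * n) choose (n + 2 * d)) / 2 ^ n"
proof -
  have "(\<Sum>k=0..n div 2. real (n choose (2 * k)) / 4 ^ k * real ((2 * k) choose (k + d)))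
      = (\<Sum>k=0..n div 2. real ((n choose (2 * k)) * 2 ^ (n - 2 * k) * ((2 * k) choose (k + d))) / 2 ^ n)"
  proof (intro sum.cong refl)
    fix k assume "k \<in> {0..n div 2}"
    \<comment> \<open>In this range 2k \<le> n, so the natural subtraction is not truncated.\<close>
    then have "(2 :: real) ^ n = 2 ^ (n - 2 * k) * 2 ^ (2 * k)"
      by (simp flip: power_add)
    then have "(2 :: real) ^ n = 2 ^ (n - 2 * k) * 4 ^ k"
      by (simp add: power_mult)
    then show "real (n choose (2 * k)) / 4 ^ k * real ((2 * k) choose (k + d))
      = real ((n choose (2 * k)) * 2 ^ (n - 2 * k) * ((2 * k) choose (k + d))) / 2 ^ n"
      by simp
  qed
  then show ?thesis
    unfolding sum_divide_distrib[symmetric] of_nat_sum[symmetric] sum_binomial_even .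
qed

text \<open>Two absorption identities give (k+1) (2k choose k+1) = k (2k choose k), so the
  difference is (1 - k/(k+1)) (2k choose k).\<close>

lemma catalan_eq_diff: "catalan k = real ((2 * k) choose k) - real ((2 * k) choose (k + 1))"
proof -
  have "Suc k * ((2 * k) choose Suc k) = k * ((2 * k) choose k)"
    using binomial_absorption[of k "2 * k"] binomial_absorb_comp[of "2 * k" k]
    by (simp only: mult_2 add_diff_cancel_right')
  then have "real (Suc k) * real ((2 * k) choose Suc k) = real k * real ((2 * k) choose k)"
    by (metis of_nat_mult)
  then show ?thesis
    by (simp add: catalan_def field_simps)
qed

text \<open>Pascal's rule is applied twice; the symmetry of row 2n + 1 makes the remaining terms
  cancel. The two binomials left are the values of \<open>sum_binomial_even_real\<close> for d = 0
  and d = 1.\<close>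

lemma catalan_Suc_eq_diff:
  "catalan (Suc n) = real ((2 * n) choose n) - real ((2 * n) choose (n + 2))"
  using binomial_symmetric[of n "Suc (2 * n)"]
  by (simp add: catalan_eq_diff)

text \<open>Touchard's identity, divided by 2^n: the case d = 0 of
  \<open>sum_binomial_even_real\<close> minus the case d = 1.\<close>

lemma touchard:
  "(\<Sum>k=0..n div 2. real (n choose (2 * k)) / 4 ^ k * catalan k) = catalan (Suc n) / 2 ^ n"
  using sum_binomial_even_real[of n 0] sum_binomial_even_real[of n 1]
  \<comment> \<open>The order matters: \<open>catalan_eq_diff\<close> would also rewrite
    \<open>catalan (Suc n)\<close>, into binomials of row 2n + 2.\<close>
  unfolding catalan_Suc_eq_diff unfolding catalan_eq_diff
  by (simp add: right_diff_distrib sum_subtractf diff_divide_distrib)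

text \<open>This recurrence accounts for the factor (2k+1)/(k+2) and the extra 2 in the third
  identity: together with C_k they form C_(k+1).\<close>

lemma catalan_Suc: "catalan (Suc k) = 2 * ((2 * real k + 1) / (real k + 2)) * catalan k"
proof -
  have "Suc k * (Suc (2 * k) choose Suc k) = Suc (2 * k) * ((2 * k) choose k)"
    by (rule Suc_times_binomial)
  then have "real (Suc k) * real (Suc (2 * k) choose Suc k) = real (Suc (2 * k)) * real ((2 * k) choose k)"
    by (metis of_nat_mult)
  then have "real (Suc (2 * k) choose Suc k) = (2 * real k + 1) / (real k + 1) * real ((2 * k) choose k)"
    by (simp add: field_simps del: binomial_Suc_Suc)
  moreover have "(2 * Suc k) choose Suc k = 2 * (Suc (2 * k) choose Suc k)"
    using binomial_symmetric[of k "Suc (2 * k)"] by simp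
  ultimately show ?thesis
    by (simp add: catalan_def del: binomial_Suc_Suc) (simp add: algebra_simps)
qed

text \<open>Absorption gives (n choose 2k)/(2k+1) = (n+1 choose 2k+1)/(n+1), and the odd-indexed
  entries of row n + 1 sum to 2^n.\<close>

lemma sum_binomial_even_div:
  "(\<Sum>k=0..n div 2. real (n choose (2 * k)) * (1 / (2 * real k + 1))) = 2 ^ n / (real n + 1)"
proof -
  have "(\<Sum>k=0..n div 2. real (n choose (2 * k)) * (1 / (2 * real k + 1)))
      = (\<Sum>k=0..n div 2. real (Suc n choose Suc (2 * k))) / (real n + 1)"
    unfolding sum_divide_distrib
  proof (intro sum.cong refl)
    fix k
    have "real (Suc (2 * k)) * real (Suc n choose Suc (2 * k)) = real (Suc n) * real (n choose (2 * k))"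
      using Suc_times_binomial[of "2 * k" n] by (metis of_nat_mult)
    then show "real (n choose (2 * k)) * (1 / (2 * real k + 1))
        = real (Suc n choose Suc (2 * k)) / (real n + 1)"
      by (simp add: field_simps del: binomial_Suc_Suc)
  qed
  also have "(\<Sum>k=0..n div 2. real (Suc n choose Suc (2 * k))) = 2 ^ n"
    using choose_odd_sum[of "Suc n", where ?'a = real] unfolding sum_odd by simp
  finally show ?thesis .
qed

lemma sum_binomial_odd_div:
  "(\<Sum>k=1..Suc n div 2. real (n choose (2 * k - 1)) * (1 / real k)) = 2 * (2 ^ n - 1) / (real n + 1)"
proof -
  have "(\<Sum>k=1..Suc n div 2. real (n choose (2 * k - 1)) * (1 / real k))
      = (\<Sum>k=1..Suc n div 2. real (Suc n choose (2 * k))) * (2 / (real n + 1))"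
    unfolding sum_distrib_right
  proof (intro sum.cong refl)
    fix k assume "k \<in> {1..Suc n div 2}"
    then have k: "Suc (2 * k - 1) = 2 * k" "k > 0" by auto
    have "real (2 * k) * real (Suc n choose (2 * k)) = real (Suc n) * real (n choose (2 * k - 1))"
      using Suc_times_binomial[of "2 * k - 1" n] unfolding k by (metis of_nat_mult)
    then show "real (n choose (2 * k - 1)) * (1 / real k)
        = real (Suc n choose (2 * k)) * (2 / (real n + 1))"
      using k by (simp add: field_simps del: binomial_Suc_Suc)
  qed
  \<comment> \<open>The even-indexed entries of row n + 1 also sum to 2^n; the -1 is the entry at
    index 0, which a sum from k = 1 omits.\<close>
  also have "(\<Sum>k=1..Suc n div 2. real (Suc n choose (2 * k))) = 2 ^ n - 1"
    using choose_even_sum[of "Suc n", where ?'a = real] unfolding sum_even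
    by (simp add: sum.atLeast_Suc_atMost)
  finally show ?thesis by simp
qed

theorem proposition3:
  fixes n :: nat
  shows "((\<Sum>k=0..n. (- 1) ^ k * real (n choose k) * 2 powi (int n - 2 * int k) * real ((2 * k) choose k))
          = (\<Sum>k=0..nat \<lfloor>real n / 2\<rfloor>. real (n choose (2 * k)) * 2 powi (- 2 * int k) * real ((2 * k) choose k))) \<and>
         (n \<noteq> 0 \<longrightarrow>
          (\<Sum>k=0..nat \<lfloor>real n / 2\<rfloor>. real (n choose (2 * k)) * (1 / (2 * real k + 1)))
          = 2 ^ (n - 1) / (2 ^ n - 1)
            * (\<Sum>k=1..nat \<lceil>real n / 2\<rceil>. real (n choose (2 * k - 1)) * (1 / real k))) \<and>
         ((\<Sum>k=0..n. (- 1) ^ k * real (n choose k) * ((2 * real k + 1) / (real k + 2))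
                * 2 powi (int n - 2 * int k + 1) * catalan k)
          = (\<Sum>k=0..nat \<lfloor>real n / 2\<rfloor>. real (n choose (2 * k)) * 2 powi (- 2 * int k) * catalan k))"
proof (intro conjI impI)
  have four: "(2 :: real) powi (- 2 * int k) = 1 / 4 ^ k" for k
    using two_powi_diff[of 0 k] by simp
  \<comment> \<open>This turns the outer 2^n times a value over 4^n into the common value over
    2^n.\<close>
  have pow: "(4 :: real) ^ n = 2 ^ n * 2 ^ n"
    by (simp flip: power_mult_distrib)
  show "(\<Sum>k=0..n. (- 1) ^ k * real (n choose k) * 2 powi (int n - 2 * int k) * real ((2 * k) choose k))
      = (\<Sum>k=0..nat \<lfloor>real n / 2\<rfloor>. real (n choose (2 * k)) * 2 powi (- 2 * int k) * real ((2 * k) choose k))"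
  proof -
    have "(\<Sum>k=0..n. (- 1) ^ k * real (n choose k) * 2 powi (int n - 2 * int k) * real ((2 * k) choose k))
        = 2 ^ n * (\<Sum>k\<le>n. (- 1) ^ k * real (n choose k) * (real ((2 * k) choose k) / 4 ^ k))"
      unfolding two_powi_diff sum_distrib_left atMost_atLeast0
      by (intro sum.cong refl) simp
    also have "\<dots> = real ((2 * n) choose n) / 2 ^ n"
      unfolding alternating_sum_central_binomial pow by simp
    finally show ?thesis
      using sum_binomial_even_real[of n 0] unfolding nat_floor_half four by simp
  qed
  show "(\<Sum>k=0..nat \<lfloor>real n / 2\<rfloor>. real (n choose (2 * k)) * (1 / (2 * real k + 1)))
      = 2 ^ (n - 1) / (2 ^ n - 1)
        * (\<Sum>k=1..nat \<lceil>real n / 2\<rceil>. real (n choose (2 * k - 1)) * (1 / real k))" if "n \<noteq> 0"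
  proof -
    \<comment> \<open>Here n \<noteq> 0 enters: 2^n - 1 can be cancelled, and 2 * 2^(n-1) is
      2^n.\<close>
    have "(2 :: real) ^ n \<noteq> 1"
      using that one_less_power[of "2 :: real" n] by (metis less_irrefl neq0_conv one_less_numeral_iff semiring_norm(76))
    moreover have "(2 :: real) ^ n = 2 * 2 ^ (n - 1)"
      using that by (simp flip: power_Suc)
    ultimately show ?thesis
      unfolding nat_floor_half nat_ceiling_half sum_binomial_even_div sum_binomial_odd_div
      by (simp add: divide_simps)
  qed
  show "(\<Sum>k=0..n. (- 1) ^ k * real (n choose k) * ((2 * real k + 1) / (real k + 2))
        * 2 powi (int n - 2 * int k + 1) * catalan k)
      = (\<Sum>k=0..nat \<lfloor>real n / 2\<rfloor>. real (n choose (2 * k)) * 2 powi (- 2 * int k) * catalan k)"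
  proof -
    have "(\<Sum>k=0..n. (- 1) ^ k * real (n choose k) * ((2 * real k + 1) / (real k + 2))
          * 2 powi (int n - 2 * int k + 1) * catalan k)
        = 2 ^ n * (\<Sum>k\<le>n. (- 1) ^ k * real (n choose k) * (catalan (Suc k) / 4 ^ k))"
      unfolding sum_distrib_left atMost_atLeast0
      by (intro sum.cong refl) (simp add: power_int_add two_powi_diff catalan_Suc)
    also have "\<dots> = catalan (Suc n) / 2 ^ n"
      unfolding alternating_sum_catalan_Suc pow by simp
    finally show ?thesis
      using touchard[of n] unfolding nat_floor_half four by simp
  qed
qed

end
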